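(* Let $\Delta$ be the graph Laplacian of an undirected connected graph $G=(X,w,\boldsymbol 1)$ with edge set $E$, let $\alpha\in(0,1)$, and let, for $i\ne j$, $${}_rw^\alpha(x_i,x_j)=\begin{cases}-(\Delta^\alpha)_{i,j}&\text{if }\{x_i,x_j\}\notin E,\\ w(x_i,x_j)&\text{if }\{x_i,x_j\}\in E.\end{cases}$$ Then there is a constant $c$, independent of the nodes, such that for all $x_i,x_j\in X$ with $\delta(x_i,x_j)\ge 2$, $$\left|{}_rw^\alpha(x_i,x_j)\right|\le c\left(\frac{\rho(\Delta)}{2\delta(x_i,x_j)-1}\right)^\alpha,$$ where $\rho(\Delta)$ is the spectral radius of $\Delta$ and $\delta$ is the combinatorial distance on $G$.
   Context: A graph $G=(X,w,\boldsymbol 1)$ consists of a finite node set $X=\{x_i:i\in I\}$ and a symmetric weight function $w:X\times X\to[0,\infty)$ with $w(x,x)=0$ for all $x$, equipped with the counting measure. A pair $\{x,y\}$ is an edge iff $w(x,y)>0$; $E$ is the set of edges; the graph is connected. Its graph Laplacian is the symmetric positive semidefinite matrix $\Delta=D-A$ with $A_{i,j}=w(x_i,x_j)$ and $D$ diagonal with $D_{i,i}=\sum_j w(x_i,x_j)$. If $\Delta=U\Lambda U^T$ is a spectral decomposition, $\Delta^\alpha:=U\Lambda^\alpha U^T$. The combinatorial distance $\delta(x,y)$ is the least number of edges in a walk joining $x$ to $y$. *)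

theory Defs
  imports "Jordan_Normal_Form.Spectral_Radius"
begin

section \<open>Weighted graphs\<close>

text \<open>The node \<open>x\<^sub>i\<close> is identified with its index \<open>i\<close>, so the node set is \<open>{..<n}\<close>; the weight
  function is only constrained, and only used, on indices below \<open>n\<close>.\<close>

definition weighted_graph :: "nat \<Rightarrow> (nat \<Rightarrow> nat \<Rightarrow> real) \<Rightarrow> bool" where
  "weighted_graph n w \<longleftrightarrow>
     (\<forall>i<n. \<forall>j<n. 0 \<le> w i j \<and> w i j = w j i) \<and> (\<forall>i<n. w i i = 0)"

definition edges :: "nat \<Rightarrow> (nat \<Rightarrow> nat \<Rightarrow> real) \<Rightarrow> nat set set" where
  "edges n w = {{i, j} | i j. i < n \<and> j < n \<and> 0 < w i j}"

definition adj_rel :: "nat \<Rightarrow> (nat \<Rightarrow> nat \<Rightarrow> real) \<Rightarrow> (nat \<times> nat) set" where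
  "adj_rel n w = {(i, j). {i, j} \<in> edges n w}"

definition connected_graph :: "nat \<Rightarrow> (nat \<Rightarrow> nat \<Rightarrow> real) \<Rightarrow> bool" where
  "connected_graph n w \<longleftrightarrow> (\<forall>i<n. \<forall>j<n. (i, j) \<in> (adj_rel n w)\<^sup>*)"

text \<open>\<open>(i, j) \<in> adj_rel n w ^^ k\<close> says that some walk with exactly \<open>k\<close> edges joins \<open>i\<close> to \<open>j\<close>.
  In a connected graph such a \<open>k\<close> exists, so the \<open>LEAST\<close> is the intended one.\<close>

definition comb_dist :: "nat \<Rightarrow> (nat \<Rightarrow> nat \<Rightarrow> real) \<Rightarrow> nat \<Rightarrow> nat \<Rightarrow> nat" where
  "comb_dist n w i j = (LEAST k. (i, j) \<in> adj_rel n w ^^ k)"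


section \<open>The graph Laplacian and its fractional powers\<close>

definition adjacency_mat :: "nat \<Rightarrow> (nat \<Rightarrow> nat \<Rightarrow> real) \<Rightarrow> real mat" where
  "adjacency_mat n w = mat n n (\<lambda>(i, j). w i j)"

definition laplacian :: "nat \<Rightarrow> (nat \<Rightarrow> nat \<Rightarrow> real) \<Rightarrow> real mat" where
  "laplacian n w = mat_diag n (\<lambda>i. \<Sum>j<n. w i j) - adjacency_mat n w"

definition spectral_decomposition :: "real mat \<Rightarrow> real mat \<Rightarrow> (nat \<Rightarrow> real) \<Rightarrow> bool" where
  "spectral_decomposition A U d \<longleftrightarrow>
     (let n = dim_row A in
       A \<in> carrier_mat n n \<and> U \<in> carrier_mat n n \<and>
       U * transpose_mat U = 1\<^sub>m n \<and> transpose_mat U * U = 1\<^sub>m n \<and>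
       A = U * mat_diag n d * transpose_mat U)"

text \<open>For \<open>\<alpha> > 0\<close> the convention \<open>0 powr \<alpha> = 0\<close> gives the right value on the kernel. The power
  does not depend on the decomposition that is chosen: see \<open>mat_powr_eq\<close> below.\<close>

definition mat_powr :: "real mat \<Rightarrow> real \<Rightarrow> real mat" where
  "mat_powr A \<alpha> =
     (SOME P. \<exists>U d. spectral_decomposition A U d \<and>
        P = U * mat_diag (dim_row A) (\<lambda>i. d i powr \<alpha>) * transpose_mat U)"

lemma mat_diag_fun_unique:
  fixes U V :: "real mat" and f :: "real \<Rightarrow> real"
  assumes [simp]: "U \<in> carrier_mat n n" "V \<in> carrier_mat n n"
    and U: "U * transpose_mat U = 1\<^sub>m n" "transpose_mat U * U = 1\<^sub>m n"
    and V: "V * transpose_mat V = 1\<^sub>m n" "transpose_mat V * V = 1\<^sub>m n"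
    and eq: "U * mat_diag n d * transpose_mat U = V * mat_diag n e * transpose_mat V"
  shows "U * mat_diag n (\<lambda>i. f (d i)) * transpose_mat U
       = V * mat_diag n (\<lambda>i. f (e i)) * transpose_mat V"
proof -
  have [simp]: "transpose_mat U \<in> carrier_mat n n" "transpose_mat V \<in> carrier_mat n n"
    by auto
  note [simp] = mult_carrier_mat[of _ n n _ n]
    left_mult_one_mat[of _ n n] right_mult_one_mat[of _ n n]
  define W where "W = transpose_mat V * U"
  have W [simp]: "W \<in> carrier_mat n n"
    unfolding W_def by (rule mult_carrier_mat[of _ n n]) auto
  have VW: "V * W = U"
    unfolding W_def by (simp add: V(1) flip: assoc_mult_mat[of _ n n _ n _ n])
  have WU: "W * transpose_mat U = transpose_mat V"
    unfolding W_def by (simp add: U(1) assoc_mult_mat[of _ n n _ n _ n])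
  have flip: "transpose_mat V * (V * M * transpose_mat V) * U = M * W"
    if [simp]: "M \<in> carrier_mat n n" for M
  proof -
    have c: "M * transpose_mat V \<in> carrier_mat n n"
      by (rule mult_carrier_mat[of _ n n]) auto
    have "transpose_mat V * (V * M * transpose_mat V) = (transpose_mat V * V) * (M * transpose_mat V)"
      using c by (simp add: assoc_mult_mat[of _ n n _ n _ n])
    also have "\<dots> = M * transpose_mat V" using c by (simp add: V(2))
    finally show ?thesis unfolding W_def by (simp add: assoc_mult_mat[of _ n n _ n _ n])
  qed
  have flop: "transpose_mat V * (U * M * transpose_mat U) * U = W * M"
    if [simp]: "M \<in> carrier_mat n n" for M
  proof -
    have c: "U * M \<in> carrier_mat n n"
      by (rule mult_carrier_mat[of _ n n]) auto
    have "U * M * transpose_mat U * U = U * M"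
      using c by (simp add: assoc_mult_mat[of "U * M" n n _ n _ n] U(2))
    moreover have "transpose_mat V * (U * M * transpose_mat U) * U
        = transpose_mat V * (U * M * transpose_mat U * U)"
      by (rule assoc_mult_mat[of _ n n _ n _ n]) (use c in auto)
    ultimately show ?thesis
      unfolding W_def by (simp add: assoc_mult_mat[of _ n n _ n _ n])
  qed
  have com: "W * mat_diag n d = mat_diag n e * W"
    using flip[of "mat_diag n e"] flop[of "mat_diag n d"] eq by simp
  have ent: "W $$ (i, j) * d j = e i * W $$ (i, j)" if "i < n" "j < n" for i j
    using arg_cong[OF com, of "\<lambda>M. M $$ (i, j)"] that
    by (simp add: mat_diag_mult_left[OF W] mat_diag_mult_right[OF W])
  have "W * mat_diag n (\<lambda>i. f (d i)) = mat_diag n (\<lambda>i. f (e i)) * W" (is "?l = ?r")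
  proof (rule eq_matI)
    fix i j assume "i < dim_row ?r" "j < dim_col ?r"
    then have ij: "i < n" "j < n" using W by (auto simp: mat_diag_def)
    have "W $$ (i, j) = 0 \<or> d j = e i" using ent[OF ij] by auto
    then show "?l $$ (i, j) = ?r $$ (i, j)"
      using ij by (auto simp: mat_diag_mult_left[OF W] mat_diag_mult_right[OF W])
  qed (use carrier_matD[OF W] in \<open>auto simp: mat_diag_def\<close>)
  note com' = this
  have "U * mat_diag n (\<lambda>i. f (d i)) * transpose_mat U
      = V * (W * mat_diag n (\<lambda>i. f (d i))) * transpose_mat U"
    by (simp flip: VW add: assoc_mult_mat[of V n n _ n _ n])
  also have "\<dots> = V * (mat_diag n (\<lambda>i. f (e i)) * (W * transpose_mat U))"
    unfolding com' by (simp add: assoc_mult_mat[of _ n n _ n _ n])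
  also have "\<dots> = V * mat_diag n (\<lambda>i. f (e i)) * transpose_mat V"
    unfolding WU by (simp add: assoc_mult_mat[of _ n n _ n _ n])
  finally show ?thesis .
qed

lemma mat_powr_eq:
  assumes "spectral_decomposition A U d"
  shows "mat_powr A \<alpha> = U * mat_diag (dim_row A) (\<lambda>i. d i powr \<alpha>) * transpose_mat U"
  unfolding mat_powr_def
proof (rule someI2)
  show "\<exists>U' d'. spectral_decomposition A U' d' \<and>
      U * mat_diag (dim_row A) (\<lambda>i. d i powr \<alpha>) * transpose_mat U
        = U' * mat_diag (dim_row A) (\<lambda>i. d' i powr \<alpha>) * transpose_mat U'"
    using assms by blast
next
  fix P
  assume "\<exists>U' d'. spectral_decomposition A U' d' \<and>
      P = U' * mat_diag (dim_row A) (\<lambda>i. d' i powr \<alpha>) * transpose_mat U'"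
  then obtain V e where V: "spectral_decomposition A V e"
    and P: "P = V * mat_diag (dim_row A) (\<lambda>i. e i powr \<alpha>) * transpose_mat V"
    by blast
  show "P = U * mat_diag (dim_row A) (\<lambda>i. d i powr \<alpha>) * transpose_mat U"
    unfolding P
    by (rule mat_diag_fun_unique[where f = "\<lambda>x. x powr \<alpha>"])
      (use V assms in \<open>auto simp: spectral_decomposition_def Let_def\<close>)
qed

definition spectral_radius_real :: "real mat \<Rightarrow> real" where
  "spectral_radius_real A = spectral_radius (map_mat complex_of_real A)"

text \<open>Only meaningful for \<open>i \<noteq> j\<close>.\<close>

definition rw :: "nat \<Rightarrow> (nat \<Rightarrow> nat \<Rightarrow> real) \<Rightarrow> real \<Rightarrow> nat \<Rightarrow> nat \<Rightarrow> real" where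
  "rw n w \<alpha> i j =
     (if {i, j} \<in> edges n w then w i j else - (mat_powr (laplacian n w) \<alpha> $$ (i, j)))"

end

theory Submission
  imports "HOL-Analysis.Generalised_Binomial_Theorem" Defs
begin

text \<open>Rescale so that the spectrum of \<open>\<Delta> / \<rho>\<close> lies in \<open>[0, 1]\<close>. The binomial series of
  \<open>x\<^sup>\<alpha> = (1 - (1 - x))\<^sup>\<alpha>\<close> has only nonpositive coefficients after the constant term, so on \<open>[0, 1]\<close>
  its truncation after degree \<open>m\<close> is worst at \<open>x = 0\<close>, where the error is
  \<open>\<Prod>\<^bsub>k=1..m\<^esub> (1 - \<alpha> / k) \<le> (m + 1)\<^bsup>-\<alpha>\<^esup>\<close>. A polynomial of degree \<open>m = \<delta>(x\<^sub>i, x\<^sub>j) - 1\<close> in \<open>\<Delta>\<close> has a zero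
  \<open>(i, j)\<close> entry, since no walk with at most \<open>m\<close> edges joins the two nodes. Hence
  \<open>\<bar>(\<Delta>\<^sup>\<alpha>)\<^bsub>i,j\<^esub>\<bar> \<le> (\<rho> / \<delta>)\<^sup>\<alpha> \<le> 2\<^sup>\<alpha> (\<rho> / (2\<delta> - 1))\<^sup>\<alpha>\<close>.\<close>

section \<open>Polynomial approximation of fractional powers\<close>

text \<open>The coefficient of \<open>y ^ k\<close> in the binomial series of
  \<open>(1 - y) powr \<alpha>\<close>.\<close>

definition binom_coeff :: "real \<Rightarrow> nat \<Rightarrow> real" where
  "binom_coeff \<alpha> k = (\<alpha> gchoose k) * (- 1) ^ k"

text \<open>The Taylor polynomial of \<open>x powr \<alpha>\<close> at \<open>x = 1\<close>. The
  powers of \<open>1 - x\<close> are kept because they stay in \<open>[0, 1]\<close> on the rescaled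
  spectrum.\<close>

definition powr_poly :: "real \<Rightarrow> nat \<Rightarrow> real \<Rightarrow> real" where
  "powr_poly \<alpha> m x = (\<Sum>k\<le>m. binom_coeff \<alpha> k * (1 - x) ^ k)"

text \<open>The partial alternating sum of binomial coefficients collapses to
  \<open>(- 1) ^ m * (\<alpha> - 1 gchoose m)\<close>, so consecutive values differ by a single
  factor. Iterating gives the product of the \<open>1 - \<alpha> / k\<close>.\<close>

lemma powr_poly_0_Suc:
  "powr_poly \<alpha> (Suc m) 0 = powr_poly \<alpha> m 0 * (1 - \<alpha> / real (Suc m))"
proof -
  have *: "powr_poly \<alpha> m 0 = (- 1) ^ m * (\<alpha> - 1 gchoose m)" for m
    by (simp add: powr_poly_def binom_coeff_def gbinomial_sum_lower_neg)
  have "real (Suc m) * (\<alpha> - 1 gchoose Suc m) = (\<alpha> - 1 - real m) * (\<alpha> - 1 gchoose m)"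
    using gbinomial_mult_1[of "\<alpha> - 1" m] by (simp add: algebra_simps)
  then have "(\<alpha> - 1 gchoose Suc m) = (\<alpha> - 1 - real m) * (\<alpha> - 1 gchoose m) / real (Suc m)"
    by (simp add: field_simps)
  moreover have "(\<alpha> - 1 - real m) / real (Suc m) = - (1 - \<alpha> / real (Suc m))"
    by (simp add: field_simps)
  ultimately have g: "(\<alpha> - 1 gchoose Suc m) = - (1 - \<alpha> / real (Suc m)) * (\<alpha> - 1 gchoose m)"
    by (metis times_divide_eq_left)
  have "(- 1) ^ Suc m * (- t * b) = (- 1) ^ m * b * t" for t b :: real
    by simp
  then show ?thesis by (simp only: * g)
qed

lemma powr_poly_0_nonneg: "0 \<le> powr_poly \<alpha> m 0" if "0 < \<alpha>" "\<alpha> < 1"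
proof (induction m)
  case 0 then show ?case by (simp add: powr_poly_def binom_coeff_def)
next
  case (Suc m)
  have "\<alpha> / real (Suc m) \<le> 1" using that by (simp add: field_simps)
  with Suc show ?case unfolding powr_poly_0_Suc by simp
qed

text \<open>With \<open>k = Suc m\<close>, the factor \<open>1 - \<alpha> / k\<close> is at most
  \<open>exp (- \<alpha> / k)\<close>, hence at most \<open>((k + 1) / k) powr - \<alpha>\<close>
  because \<open>ln (1 + 1 / k) \<le> 1 / k\<close>. The product of these bounds telescopes.\<close>

lemma powr_poly_0_le: "powr_poly \<alpha> m 0 \<le> real (Suc m) powr - \<alpha>" if "0 < \<alpha>" "\<alpha> < 1"
proof (induction m)
  case 0 then show ?case by (simp add: powr_poly_def binom_coeff_def)
next
  case (Suc m)
  have pos: "1 + 1 / real (Suc m) \<noteq> 0" using add_pos_pos[of 1 "1 / real (Suc m)"] by simp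
  have "ln (1 + 1 / real (Suc m)) \<le> 1 / real (Suc m)" by (rule ln_add_one_self_le_self) simp
  then have l: "\<alpha> * ln (1 + 1 / real (Suc m)) \<le> \<alpha> / real (Suc m)"
    using that mult_left_mono[of "ln (1 + 1 / real (Suc m))" "1 / real (Suc m)" \<alpha>] by simp
  have "1 - \<alpha> / real (Suc m) \<le> exp (- (\<alpha> / real (Suc m)))"
    using exp_ge_add_one_self[of "- (\<alpha> / real (Suc m))"] by simp
  also have "\<dots> \<le> exp (- \<alpha> * ln (1 + 1 / real (Suc m)))"
    using l by simp
  also have "\<dots> = (1 + 1 / real (Suc m)) powr - \<alpha>"
    using pos by (simp only: powr_def) simp
  finally have "powr_poly \<alpha> (Suc m) 0 \<le> real (Suc m) powr - \<alpha> * (1 + 1 / real (Suc m)) powr - \<alpha>"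
    unfolding powr_poly_0_Suc using that powr_poly_0_nonneg[OF that, of m]
    by (intro mult_mono Suc.IH) (simp_all add: field_simps)
  also have "\<dots> = (real (Suc m) * (1 + 1 / real (Suc m))) powr - \<alpha>"
    by (simp add: powr_mult)
  also have "real (Suc m) * (1 + 1 / real (Suc m)) = real (Suc (Suc m))"
    by (simp add: field_simps)
  finally show ?case .
qed

text \<open>At \<open>x = 0\<close> every power of \<open>1 - x\<close> is 1, so the coefficient is
  an increment of the sequence \<open>powr_poly \<alpha> k 0\<close>, which is nonnegative and is
  multiplied by a factor of at most 1 at each step.\<close>

lemma binom_coeff_nonpos: "binom_coeff \<alpha> (Suc k) \<le> 0" if "0 < \<alpha>" "\<alpha> < 1"
proof -
  have "binom_coeff \<alpha> (Suc k) = powr_poly \<alpha> (Suc k) 0 - powr_poly \<alpha> k 0"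
    by (simp add: powr_poly_def)
  also have "\<dots> = - (powr_poly \<alpha> k 0 * \<alpha> / real (Suc k))"
    unfolding powr_poly_0_Suc by (simp add: algebra_simps)
  finally show ?thesis using powr_poly_0_nonneg[OF that, of k] that by simp
qed

text \<open>The difference is the sum of \<open>- binom_coeff \<alpha> k * (1 - x) ^ k\<close> over
  \<open>m < k \<le> m + l\<close>. Each term is nonnegative and largest at \<open>x = 0\<close>.
  Working with finite \<open>l\<close> avoids the question of convergence at 0.\<close>

lemma powr_poly_diff:
  assumes "0 < \<alpha>" "\<alpha> < 1" "0 \<le> x" "x \<le> 1"
  shows "0 \<le> powr_poly \<alpha> m x - powr_poly \<alpha> (m + l) x \<and>
    powr_poly \<alpha> m x - powr_poly \<alpha> (m + l) x \<le> powr_poly \<alpha> m 0 - powr_poly \<alpha> (m + l) 0"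
proof (induction l)
  case (Suc l)
  let ?b = "binom_coeff \<alpha> (Suc (m + l))" and ?y = "(1 - x) ^ Suc (m + l)"
  have b: "?b \<le> 0" using assms binom_coeff_nonpos by blast
  have "0 \<le> ?y" by (rule zero_le_power) (use assms in simp)
  moreover have "?y \<le> 1" by (rule power_le_one) (use assms in auto)
  ultimately have "?b * ?y \<le> 0" "?b \<le> ?b * ?y"
    using b by (auto simp: mult_nonpos_nonneg mult_le_cancel_left1 simp del: power_Suc)
  moreover have "powr_poly \<alpha> (m + Suc l) x = powr_poly \<alpha> (m + l) x + ?b * ?y"
    "powr_poly \<alpha> (m + Suc l) 0 = powr_poly \<alpha> (m + l) 0 + ?b" by (simp_all add: powr_poly_def)
  ultimately show ?case using Suc.IH by linarith
qed simp

lemma powr_poly_approx: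
  assumes \<alpha>: "0 < \<alpha>" "\<alpha> < 1" and x: "0 \<le> x" "x \<le> 1"
  shows "\<bar>x powr \<alpha> - powr_poly \<alpha> m x\<bar> \<le> real (Suc m) powr - \<alpha>"
\<comment> \<open>The point \<open>x = 0\<close> lies on the boundary of the disc of convergence
  around 1. There \<open>0 powr \<alpha> = 0\<close>, so the error is
  \<open>powr_poly \<alpha> m 0\<close> itself.\<close>
proof (cases "x = 0")
  case True
  then show ?thesis using powr_poly_0_nonneg[OF \<alpha>, of m] powr_poly_0_le[OF \<alpha>, of m] by simp
next
  case False
  have "(\<lambda>k. (\<alpha> gchoose k) * (x - 1) ^ k) sums (1 + (x - 1)) powr \<alpha>"
    using x False by (intro gen_binomial_real) auto
  moreover have "(\<alpha> gchoose k) * (x - 1) ^ k = binom_coeff \<alpha> k * (1 - x) ^ k" for k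
    by (simp add: binom_coeff_def flip: power_mult_distrib)
  ultimately have "(\<lambda>m. powr_poly \<alpha> m x) \<longlonglongrightarrow> x powr \<alpha>"
    by (simp add: sums_def_le powr_poly_def)
  then have "(\<lambda>l. powr_poly \<alpha> (m + l) x) \<longlonglongrightarrow> x powr \<alpha>"
    by (subst add.commute) (rule LIMSEQ_ignore_initial_segment)
  then have lim: "(\<lambda>l. powr_poly \<alpha> m x - powr_poly \<alpha> (m + l) x) \<longlonglongrightarrow> powr_poly \<alpha> m x - x powr \<alpha>"
    by (intro tendsto_intros)
  have "0 \<le> powr_poly \<alpha> m x - x powr \<alpha>"
    using lim powr_poly_diff[OF assms] by (intro LIMSEQ_le_const) auto
  \<comment> \<open>Dropping the nonnegative \<open>powr_poly \<alpha> (m + l) 0\<close> makes the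
    bound uniform in \<open>l\<close>, so it survives the limit.\<close>
  moreover have "powr_poly \<alpha> m x - x powr \<alpha> \<le> real (Suc m) powr - \<alpha>"
    using powr_poly_diff[OF assms] powr_poly_0_nonneg[OF \<alpha>] powr_poly_0_le[OF \<alpha>, of m]
    by (intro LIMSEQ_le_const2[OF lim]) (smt (verit))
  ultimately show ?thesis by linarith
qed


section \<open>The spectral theorem for real symmetric matrices\<close>

lemma symmetric_mat_entry:
  assumes "A \<in> carrier_mat n n" "transpose_mat A = A" "i < n" "j < n"
  shows "A $$ (i, j) = A $$ (j, i)"
  using assms by (metis carrier_matD index_transpose_mat(1))

text \<open>The Hermitian form \<open>q\<close> of an eigenvector \<open>z\<close> is its own
  conjugate by symmetry of \<open>A\<close>, and it equals \<open>k\<close> times the squared norm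
  \<open>r\<close> of \<open>z\<close>, which is not 0.\<close>

lemma symmetric_eigenvalue_Reals:
  fixes A :: "real mat"
  assumes A: "A \<in> carrier_mat n n" "transpose_mat A = A"
    and ev: "eigenvalue (map_mat complex_of_real A) k"
  shows "k \<in> \<real>"
proof -
  obtain z where z: "z \<in> carrier_vec n" "z \<noteq> 0\<^sub>v n"
    and eq: "map_mat complex_of_real A *\<^sub>v z = k \<cdot>\<^sub>v z"
    using ev A unfolding eigenvalue_def eigenvector_def by auto
  define q where "q = (\<Sum>i<n. \<Sum>j<n. cnj (z $ i) * complex_of_real (A $$ (i, j)) * z $ j)"
  define r where "r = (\<Sum>i<n. (cmod (z $ i))\<^sup>2)"
  have row: "(\<Sum>j<n. complex_of_real (A $$ (i, j)) * z $ j) = k * z $ i" if "i < n" for i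
    using arg_cong[OF eq, of "\<lambda>v. v $ i"] that A z
    by (simp add: scalar_prod_def lessThan_atLeast0)
  have "q = (\<Sum>i<n. cnj (z $ i) * (\<Sum>j<n. complex_of_real (A $$ (i, j)) * z $ j))"
    unfolding q_def by (simp add: sum_distrib_left mult.assoc)
  also have "\<dots> = (\<Sum>i<n. k * (z $ i * cnj (z $ i)))"
    by (intro sum.cong refl) (auto simp: row)
  also have "\<dots> = k * complex_of_real r"
    unfolding r_def by (simp add: sum_distrib_left complex_norm_square del: of_real_power)
  finally have qr: "q = k * complex_of_real r" .
  have "cnj q = (\<Sum>i<n. \<Sum>j<n. z $ i * complex_of_real (A $$ (i, j)) * cnj (z $ j))"
    unfolding q_def by simp
  also have "\<dots> = (\<Sum>j<n. \<Sum>i<n. z $ i * complex_of_real (A $$ (i, j)) * cnj (z $ j))"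
    by (rule sum.swap)
  also have "\<dots> = q"
    unfolding q_def by (intro sum.cong refl) (auto simp: symmetric_mat_entry[OF A] mult_ac)
  finally have "q \<in> \<real>" by (simp add: Reals_cnj_iff)
  moreover have "r \<noteq> 0"
  proof
    assume "r = 0"
    then have "\<forall>i<n. z $ i = 0" unfolding r_def by (subst (asm) sum_nonneg_eq_0_iff) auto
    with z show False by auto
  qed
  then have "k = q / complex_of_real r" using qr by simp
  ultimately show ?thesis by simp
qed

text \<open>Both sides say that \<open>e\<close> is a root of the same characteristic polynomial.
  Left to right, this turns a real eigenvalue with a complex eigenvector into one with a real
  eigenvector.\<close>

lemma eigenvalue_map_of_real:
  fixes A :: "real mat"
  assumes A: "A \<in> carrier_mat n n"
  shows "eigenvalue (map_mat complex_of_real A) (complex_of_real e) \<longleftrightarrow> eigenvalue A e"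
proof -
  have "map_mat complex_of_real A \<in> carrier_mat n n" using A by simp
  then show ?thesis
    by (simp add: eigenvalue_root_char_poly eigenvalue_root_char_poly[OF A]
        of_real_hom.char_poly_hom[OF A])
qed

text \<open>An eigenvalue exists over the complex numbers; by symmetry it is real, hence has a real
  eigenvector, which is then normalised.\<close>

lemma symmetric_unit_eigenvector:
  fixes A :: "real mat"
  assumes A: "A \<in> carrier_mat n n" "transpose_mat A = A" and n: "0 < n"
  obtains v e where "v \<in> carrier_vec n" "scalar_prod v v = 1" "A *\<^sub>v v = e \<cdot>\<^sub>v v"
proof -
  have cA: "map_mat complex_of_real A \<in> carrier_mat n n" using A by simp
  obtain k where k: "eigenvalue (map_mat complex_of_real A) k"
    using spectrum_non_empty[OF cA n] by (auto simp: spectrum_def)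
  with symmetric_eigenvalue_Reals[OF A] obtain e where e: "k = complex_of_real e"
    by (auto elim: Reals_cases)
  have "eigenvalue A e" using k by (simp add: e eigenvalue_map_of_real[OF A(1)])
  then obtain x where x: "x \<in> carrier_vec n" "x \<noteq> 0\<^sub>v n" "A *\<^sub>v x = e \<cdot>\<^sub>v x"
    using A unfolding eigenvalue_def eigenvector_def by auto
  have pos: "0 < scalar_prod x x"
  proof -
    obtain i where i: "i < n" "x $ i \<noteq> 0"
      using x(1,2) eq_vecI[of x "0\<^sub>v n"] by auto
    have "0 < (\<Sum>j<n. x $ j * x $ j)"
      by (rule sum_pos2[of _ i]) (use i in \<open>auto simp: zero_less_mult_iff\<close>)
    then show ?thesis using x by (simp add: scalar_prod_def lessThan_atLeast0)
  qed
  let ?c = "1 / sqrt (scalar_prod x x)"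
  show thesis
  proof
    show "?c \<cdot>\<^sub>v x \<in> carrier_vec n" using x by simp
    show "scalar_prod (?c \<cdot>\<^sub>v x) (?c \<cdot>\<^sub>v x) = 1" using x pos
      by (simp add: field_simps)
    show "A *\<^sub>v (?c \<cdot>\<^sub>v x) = e \<cdot>\<^sub>v (?c \<cdot>\<^sub>v x)" using x A
      by (simp add: mult_mat_vec[OF A(1) x(1)] smult_smult_assoc mult.commute)
  qed
qed

text \<open>The Householder reflection swapping \<open>v\<close> and the first unit vector. If these two are equal,
  then \<open>2 / (u \<bullet> u)\<close> is \<open>2 / 0 = 0\<close> and the formula gives the identity.\<close>

lemma householder_exists:
  fixes v :: "real vec"
  assumes v: "v \<in> carrier_vec n" "scalar_prod v v = 1" and n: "0 < n"
  obtains H where "H \<in> carrier_mat n n" "transpose_mat H = H" "H * H = 1\<^sub>m n"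
    "H *\<^sub>v v = unit_vec n 0"
proof -
  define u where "u i = v $ i - (if i = 0 then 1 else 0)" for i
  define s where "s = (\<Sum>i<n. u i * u i)"
  have vv: "(\<Sum>i<n. v $ i * v $ i) = 1"
    using v by (simp add: scalar_prod_def lessThan_atLeast0)
  have "(\<Sum>i<n. u i * v $ i) = (\<Sum>i<n. v $ i * v $ i - (if i = 0 then v $ 0 else 0))"
    unfolding u_def by (intro sum.cong refl) (auto simp: algebra_simps)
  then have uv: "(\<Sum>i<n. u i * v $ i) = 1 - v $ 0"
    using n vv by (simp add: sum_subtractf)
  \<comment> \<open>Since \<open>v\<close> is a unit vector, \<open>s\<close>, the squared length of
    \<open>u\<close>, is twice the inner product of \<open>u\<close> and \<open>v\<close>. Hence the
    reflection subtracts exactly \<open>u\<close> from \<open>v\<close>.\<close>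
  have "s = (\<Sum>i<n. v $ i * v $ i - (if i = 0 then 2 * v $ 0 - 1 else 0))"
    unfolding s_def u_def by (intro sum.cong refl) (auto simp: algebra_simps)
  then have s: "s = 2 * (1 - v $ 0)"
    using n vv by (simp add: sum_subtractf)
  define c where "c = 2 / s"
  \<comment> \<open>The factor \<open>u i\<close> lets the identity cover \<open>s = 0\<close> too:
    then \<open>c * s\<close> is 0 rather than 2, but \<open>u\<close> vanishes.\<close>
  have csu: "c * s * u i = 2 * u i" if "i < n" for i
  proof (cases "s = 0")
    case True
    then have "\<forall>i\<in>{..<n}. u i * u i = 0"
      unfolding s_def by (subst (asm) sum_nonneg_eq_0_iff) auto
    then show ?thesis using that by simp
  qed (simp add: c_def)
  define H where "H = mat n n (\<lambda>(i, j). (if i = j then 1 else 0) - c * u i * u j)"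
  show thesis
  proof
    show H: "H \<in> carrier_mat n n" unfolding H_def by simp
    show "transpose_mat H = H" by (rule eq_matI) (auto simp: H_def mult_ac)
    show "H * H = 1\<^sub>m n"
    proof (rule eq_matI)
      fix i j assume "i < dim_row (1\<^sub>m n :: real mat)" "j < dim_col (1\<^sub>m n :: real mat)"
      then have ij: "i < n" "j < n" by auto
      have "(H * H) $$ (i, j) = (\<Sum>k<n. ((if i = k then 1 else 0) - c * u i * u k) *
          ((if k = j then 1 else 0) - c * u k * u j))"
        using ij by (simp add: H_def scalar_prod_def lessThan_atLeast0)
      also have "\<dots> = (\<Sum>k<n. (if i = k then (if i = j then 1 else 0) else 0)
          - (if i = k then c * u i * u j else 0) - (if k = j then c * u i * u j else 0)
          + c * u i * c * u j * (u k * u k))"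
        by (intro sum.cong refl) (auto simp: algebra_simps)
      also have "\<dots> = (if i = j then 1 else 0) - 2 * (c * u i * u j) + c * u i * c * u j * s"
        unfolding s_def sum.distrib sum_subtractf sum_distrib_left[symmetric] using ij by simp
      also have "c * u i * c * u j * s = (c * s * u i) * (c * u j)" by (simp add: mult_ac)
      also have "(if i = j then 1 else 0) - 2 * (c * u i * u j) + (c * s * u i) * (c * u j)
          = 1\<^sub>m n $$ (i, j)"
        unfolding csu[OF ij(1)] using ij by simp
      finally show "(H * H) $$ (i, j) = (1\<^sub>m n) $$ (i, j)" .
    qed (auto simp: H_def)
    show "H *\<^sub>v v = unit_vec n 0"
    proof (rule eq_vecI)
      fix i assume "i < dim_vec (unit_vec n 0 :: real vec)"
      then have i: "i < n" by simp
      have "(H *\<^sub>v v) $ i = (\<Sum>k<n. ((if i = k then 1 else 0) - c * u i * u k) * v $ k)"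
        using i v by (simp add: H_def scalar_prod_def lessThan_atLeast0)
      also have "\<dots> = (\<Sum>k<n. (if i = k then v $ i else 0) - c * u i * (u k * v $ k))"
        by (intro sum.cong refl) (auto simp: algebra_simps)
      also have "\<dots> = v $ i - c * u i * (1 - v $ 0)"
        unfolding sum_subtractf sum_distrib_left[symmetric] uv using i by simp
      also have "\<dots> = v $ i - c * s * u i / 2" by (simp add: s)
      also have "\<dots> = unit_vec n 0 $ i" using i n by (simp add: csu) (simp add: u_def)
      finally show "(H *\<^sub>v v) $ i = unit_vec n 0 $ i" .
    qed (auto simp: H_def)
  qed
qed

text \<open>A symmetric involution is orthogonal, so \<open>H * U\<close> is again orthogonal. This
  undoes the reflection in the induction below.\<close>

lemma spectral_decomposition_conj:
  assumes A: "A \<in> carrier_mat n n" and H: "H \<in> carrier_mat n n" "transpose_mat H = H" "H * H = 1\<^sub>m n"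
    and sd: "spectral_decomposition (H * A * H) U d"
  shows "spectral_decomposition A (H * U) d"
proof -
  have U: "U \<in> carrier_mat n n" "U * transpose_mat U = 1\<^sub>m n" "transpose_mat U * U = 1\<^sub>m n"
    and eq: "H * A * H = U * mat_diag n d * transpose_mat U"
    using sd H(1) unfolding spectral_decomposition_def Let_def by simp_all
  have U': "transpose_mat U \<in> carrier_mat n n" using U by simp
  have D: "mat_diag n d \<in> carrier_mat n n" by simp
  note c = mult_carrier_mat[of _ n n _ n]
  note a = assoc_mult_mat[of _ n n _ n _ n]
  have t: "transpose_mat (H * U) = transpose_mat U * H"
    using transpose_mult[OF H(1) U(1)] H by simp
  have "(H * U) * (transpose_mat U * H) = H * (U * transpose_mat U) * H"
    using H(1) U(1) U' c by (simp add: a)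
  also have "\<dots> = 1\<^sub>m n" using H U by simp
  finally have 1: "(H * U) * (transpose_mat U * H) = 1\<^sub>m n" .
  have "(transpose_mat U * H) * (H * U) = transpose_mat U * ((H * H) * U)"
    using H(1) U(1) U' c by (simp add: a)
  also have "\<dots> = 1\<^sub>m n" using H U by simp
  finally have 2: "(transpose_mat U * H) * (H * U) = 1\<^sub>m n" .
  have conj: "H * (U * D * V) * H = (H * U) * D * (V * H)"
    if "D \<in> carrier_mat n n" "V \<in> carrier_mat n n" for D V
    using H(1) U(1) that c by (simp add: a)
  have "A = (H * H) * A * (H * H)" using H A by simp
  also have "\<dots> = H * (H * A * H) * H" using H(1) A c by (simp add: a)
  also have "\<dots> = (H * U) * mat_diag n d * (transpose_mat U * H)"
    unfolding eq using D U' by (rule conj)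
  finally show ?thesis
    using A H(1) U(1) 1 2 c unfolding spectral_decomposition_def Let_def t by simp
qed

text \<open>Puts a split-off eigenvalue back: \<open>case_nat e d\<close> lists \<open>e\<close> at
  index 0 and shifts \<open>d\<close> by one.\<close>

lemma spectral_decomposition_block:
  assumes "spectral_decomposition A U d" and A: "A \<in> carrier_mat n n"
  shows "spectral_decomposition
    (four_block_mat (mat 1 1 (\<lambda>_. e)) (0\<^sub>m 1 n) (0\<^sub>m n 1) A)
    (four_block_mat (1\<^sub>m 1) (0\<^sub>m 1 n) (0\<^sub>m n 1) U) (case_nat e d)"
proof -
  have U: "U \<in> carrier_mat n n" "U * transpose_mat U = 1\<^sub>m n" "transpose_mat U * U = 1\<^sub>m n"
    and eq: "A = U * mat_diag n d * transpose_mat U"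
    using assms unfolding spectral_decomposition_def Let_def by auto
  let ?V = "four_block_mat (1\<^sub>m 1) (0\<^sub>m 1 n) (0\<^sub>m n 1) U"
  have t: "transpose_mat ?V = four_block_mat (1\<^sub>m 1) (0\<^sub>m 1 n) (0\<^sub>m n 1) (transpose_mat U)"
    using U by (subst transpose_four_block_mat[of _ 1 1 _ n _ n]) auto
  have D: "mat_diag (1 + n) (case_nat e d)
      = four_block_mat (mat 1 1 (\<lambda>_. e)) (0\<^sub>m 1 n) (0\<^sub>m n 1) (mat_diag n d)"
    by (rule eq_matI) (auto simp: mat_diag_def split: nat.split)
  have m: "four_block_mat P (0\<^sub>m 1 n) (0\<^sub>m n 1) M * four_block_mat Q (0\<^sub>m 1 n) (0\<^sub>m n 1) N
      = four_block_mat (P * Q) (0\<^sub>m 1 n) (0\<^sub>m n 1) (M * N)"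
    if "P \<in> carrier_mat 1 1" "Q \<in> carrier_mat 1 1" "M \<in> carrier_mat n n" "N \<in> carrier_mat n n"
    for P Q M N :: "real mat"
    using that by (subst mult_four_block_mat[of _ 1 1 _ n _ n _ _ 1 _ n]) auto
  have o: "four_block_mat (1\<^sub>m 1) (0\<^sub>m 1 n) (0\<^sub>m n 1) (1\<^sub>m n) = (1\<^sub>m (Suc n) :: real mat)"
    by simp
  have Ut: "transpose_mat U \<in> carrier_mat n n" and UD: "U * mat_diag n d \<in> carrier_mat n n"
    using U by (auto intro: mult_carrier_mat[of _ n n _ n])
  show ?thesis
    unfolding spectral_decomposition_def Let_def
    using U A Ut UD by (auto simp: t m D o eq[symmetric] simp del: four_block_one_mat One_nat_def)
qed

text \<open>Induction by deflation: a reflection moves a unit eigenvector to the first basis vector.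
  In the new basis the matrix splits into the eigenvalue and a smaller symmetric block.\<close>

theorem symmetric_spectral_decomposition:
  fixes A :: "real mat"
  assumes "A \<in> carrier_mat n n" "transpose_mat A = A"
  shows "\<exists>U d. spectral_decomposition A U d"
  using assms
proof (induction n arbitrary: A)
  case 0
  then have "spectral_decomposition A A (\<lambda>_. 0)"
    by (auto simp: spectral_decomposition_def)
  then show ?case by blast
next
  case (Suc n)
  let ?N = "Suc n"
  note A = Suc.prems
  obtain v e where v: "v \<in> carrier_vec ?N" "scalar_prod v v = 1" "A *\<^sub>v v = e \<cdot>\<^sub>v v"
    using symmetric_unit_eigenvector[OF A] by blast
  obtain H where H: "H \<in> carrier_mat ?N ?N" "transpose_mat H = H" "H * H = 1\<^sub>m ?N"
    "H *\<^sub>v v = unit_vec ?N 0"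
    using householder_exists[OF v(1,2)] by blast
  define B where "B = H * A * H"
  have HA: "H * A \<in> carrier_mat ?N ?N" using H(1) A(1) by (rule mult_carrier_mat)
  have B: "B \<in> carrier_mat ?N ?N" unfolding B_def using HA H(1) by (rule mult_carrier_mat)
  have "transpose_mat B = H * (transpose_mat A * H)"
    unfolding B_def using transpose_mult[OF HA H(1)] transpose_mult[OF H(1) A(1)] H by simp
  then have Bt: "transpose_mat B = B"
    unfolding B_def using H(1) A by (simp add: assoc_mult_mat[of _ ?N ?N _ ?N _ ?N])
  have "H *\<^sub>v unit_vec ?N 0 = (H * H) *\<^sub>v v"
    using H(1) v(1) by (simp add: assoc_mult_mat_vec[of _ ?N ?N _ ?N] H(4))
  then have Hu: "H *\<^sub>v unit_vec ?N 0 = v" using H v by simp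
  \<comment> \<open>\<open>H\<close> takes the first basis vector to \<open>v\<close>,
    \<open>A\<close> scales it by \<open>e\<close>, and \<open>H\<close> takes it back.\<close>
  have "col B 0 = B *\<^sub>v unit_vec ?N 0" using B
    by (intro eq_vecI) auto
  also have "\<dots> = H *\<^sub>v (A *\<^sub>v v)"
    unfolding B_def using H(1) A(1) HA v(1)
    by (simp add: assoc_mult_mat_vec[of _ ?N ?N _ ?N] Hu)
  also have "\<dots> = e \<cdot>\<^sub>v unit_vec ?N 0"
    using v H by (simp add: mult_mat_vec[OF H(1)])
  finally have colB: "col B 0 = e \<cdot>\<^sub>v unit_vec ?N 0" .
  have B0: "B $$ (i, 0) = (if i = 0 then e else 0)" if "i < ?N" for i
    using arg_cong[OF colB, of "\<lambda>x. x $ i"] that B by simp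
  define C where "C = mat n n (\<lambda>(i, j). B $$ (Suc i, Suc j))"
  have "B = four_block_mat (mat 1 1 (\<lambda>_. e)) (0\<^sub>m 1 n) (0\<^sub>m n 1) C"
  proof (rule eq_matI)
    fix i j
    assume "i < dim_row (four_block_mat (mat 1 1 (\<lambda>_. e)) (0\<^sub>m 1 n) (0\<^sub>m n 1) C)"
      and "j < dim_col (four_block_mat (mat 1 1 (\<lambda>_. e)) (0\<^sub>m 1 n) (0\<^sub>m n 1) C)"
    then have ij: "i < ?N" "j < ?N" by (auto simp: C_def)
    then show "B $$ (i, j) = four_block_mat (mat 1 1 (\<lambda>_. e)) (0\<^sub>m 1 n) (0\<^sub>m n 1) C $$ (i, j)"
      \<comment> \<open>The first column is known from \<open>B0\<close>; symmetry of
        \<open>B\<close> then clears the first row.\<close>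
      using B0 symmetric_mat_entry[OF B Bt, of 0 j] by (auto simp: C_def)
  qed (use B in \<open>auto simp: C_def\<close>)
  moreover have C: "C \<in> carrier_mat n n" "transpose_mat C = C"
    using symmetric_mat_entry[OF B Bt] by (auto simp: C_def intro!: eq_matI)
  moreover obtain U d where "spectral_decomposition C U d" using Suc.IH[OF C] by blast
  ultimately obtain V f where "spectral_decomposition B V f"
    using spectral_decomposition_block by metis
  then show ?case
    using spectral_decomposition_conj[OF A(1) H(1-3)] unfolding B_def by blast
qed

section \<open>Entries and eigenvalues in a spectral decomposition\<close>

context
  fixes A U :: "real mat" and d :: "nat \<Rightarrow> real" and n :: nat
  assumes sd: "spectral_decomposition A U d" and A: "A \<in> carrier_mat n n"
begin

lemma spectral_decomposition_carrier: "U \<in> carrier_mat n n"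
  using sd A unfolding spectral_decomposition_def Let_def by simp

lemma orthogonal_rows:
  assumes "i < n" "j < n"
  shows "(\<Sum>a<n. U $$ (i, a) * U $$ (j, a)) = (if i = j then 1 else 0)"
proof -
  have "(U * transpose_mat U) $$ (i, j) = (1\<^sub>m n) $$ (i, j)"
    using sd A unfolding spectral_decomposition_def Let_def by simp
  then show ?thesis using assms spectral_decomposition_carrier
    by (simp add: scalar_prod_def lessThan_atLeast0)
qed

lemma orthogonal_cols:
  assumes "a < n" "b < n"
  shows "(\<Sum>i<n. U $$ (i, a) * U $$ (i, b)) = (if a = b then 1 else 0)"
proof -
  have "(transpose_mat U * U) $$ (a, b) = (1\<^sub>m n) $$ (a, b)"
    using sd A unfolding spectral_decomposition_def Let_def by simp
  then show ?thesis using assms spectral_decomposition_carrier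
    by (simp add: scalar_prod_def lessThan_atLeast0)
qed

lemma mat_powr_entry:
  assumes "i < n" "j < n"
  shows "mat_powr A \<alpha> $$ (i, j) = (\<Sum>a<n. U $$ (i, a) * d a powr \<alpha> * U $$ (j, a))"
  using mat_powr_eq[OF sd] A spectral_decomposition_carrier assms
  by (simp add: mat_diag_mult_right[OF spectral_decomposition_carrier] scalar_prod_def lessThan_atLeast0)

lemma eigen_equation:
  assumes "i < n" "a < n"
  shows "(\<Sum>j<n. A $$ (i, j) * U $$ (j, a)) = d a * U $$ (i, a)"
proof -
  note U = spectral_decomposition_carrier
  have eq: "A = U * mat_diag n d * transpose_mat U" "transpose_mat U * U = 1\<^sub>m n"
    using sd A unfolding spectral_decomposition_def Let_def by auto
  have UD: "U * mat_diag n d \<in> carrier_mat n n" by (rule mult_carrier_mat[OF U]) simp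
  have "A * U = U * mat_diag n d * (transpose_mat U * U)"
    unfolding eq(1) using U by (intro assoc_mult_mat[OF UD]) auto
  then have "A * U = U * mat_diag n d"
    by (simp only: eq(2) right_mult_one_mat[OF UD])
  then have "(A * U) $$ (i, a) = (U * mat_diag n d) $$ (i, a)" by simp
  then show ?thesis using assms U A
    by (simp add: mat_diag_mult_right[OF U] scalar_prod_def lessThan_atLeast0 mult.commute)
qed

text \<open>Column \<open>a\<close> of \<open>U\<close> is an eigenvector, nonzero because its
  squared entries sum to 1. Thus \<open>d a\<close> is in the complex spectrum, over which the
  spectral radius is the maximal modulus.\<close>

lemma abs_eigenvalue_le_spectral_radius:
  assumes a: "a < n"
  shows "\<bar>d a\<bar> \<le> spectral_radius_real A"
proof -
  note U = spectral_decomposition_carrier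
  let ?v = "col U a"
  have "A *\<^sub>v ?v = d a \<cdot>\<^sub>v ?v"
    by (rule eq_vecI)
      (use A U a eigen_equation in \<open>auto simp: scalar_prod_def lessThan_atLeast0\<close>)
  moreover have "?v \<noteq> 0\<^sub>v n"
  proof
    assume zero: "?v = 0\<^sub>v n"
    have "U $$ (i, a) = 0" if "i < n" for i
    proof -
      have "?v $ i = U $$ (i, a)" using U a that by simp
      then show ?thesis unfolding zero using that by simp
    qed
    then show False using orthogonal_cols[OF a a] by simp
  qed
  ultimately have "eigenvalue A (d a)"
    using U A a unfolding eigenvalue_def eigenvector_def by (intro exI[of _ ?v]) auto
  then have "complex_of_real (d a) \<in> spectrum (map_mat complex_of_real A)"
    by (simp add: spectrum_def eigenvalue_map_of_real[OF A])
  then have "norm (complex_of_real (d a)) \<in> norm ` spectrum (map_mat complex_of_real A)"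
    by (rule imageI)
  then have "norm (complex_of_real (d a)) \<le> spectral_radius_real A"
    unfolding spectral_radius_real_def
    using A a by (intro spectral_radius_mem_max(2)[of _ n]) auto
  then show ?thesis by simp
qed

text \<open>An entrywise form of the operator norm bound for a function of \<open>A\<close>: the
  product of two entries of \<open>U\<close> is at most the mean of their squares, and each row of
  \<open>U\<close> has length 1.\<close>

lemma spectral_sum_le:
  assumes "i < n" "j < n" and f: "\<And>a. a < n \<Longrightarrow> \<bar>f a\<bar> \<le> e"
  shows "\<bar>\<Sum>a<n. U $$ (i, a) * f a * U $$ (j, a)\<bar> \<le> e"
proof -
  have "\<bar>\<Sum>a<n. U $$ (i, a) * f a * U $$ (j, a)\<bar> \<le> (\<Sum>a<n. \<bar>U $$ (i, a) * f a * U $$ (j, a)\<bar>)"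
    by (rule sum_abs)
  also have "\<dots> \<le> (\<Sum>a<n. e * ((U $$ (i, a) * U $$ (i, a) + U $$ (j, a) * U $$ (j, a)) / 2))"
  proof (rule sum_mono)
    fix a assume "a \<in> {..<n}"
    then have e: "\<bar>f a\<bar> \<le> e" using f by simp
    let ?x = "U $$ (i, a)" and ?y = "U $$ (j, a)"
    have "0 \<le> (\<bar>?x\<bar> - \<bar>?y\<bar>)\<^sup>2" by simp
    then have "\<bar>?x\<bar> * \<bar>?y\<bar> \<le> (?x * ?x + ?y * ?y) / 2"
      by (simp add: power2_eq_square algebra_simps)
    with e have "\<bar>f a\<bar> * (\<bar>?x\<bar> * \<bar>?y\<bar>) \<le> e * ((?x * ?x + ?y * ?y) / 2)"
      by (intro mult_mono) auto
    then show "\<bar>?x * f a * ?y\<bar> \<le> e * ((?x * ?x + ?y * ?y) / 2)"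
      by (simp add: abs_mult mult_ac)
  qed
  also have "\<dots> = e"
    using orthogonal_rows[of i i] orthogonal_rows[of j j] assms
    by (simp add: sum.distrib flip: sum_distrib_left sum_divide_distrib)
  finally show ?thesis .
qed

end


section \<open>Powers of the graph Laplacian\<close>

lemma laplacian_carrier: "laplacian n w \<in> carrier_mat n n"
  by (auto simp: laplacian_def adjacency_mat_def mat_diag_def)

lemma laplacian_entry:
  assumes "i < n" "j < n"
  shows "laplacian n w $$ (i, j) = (if i = j then \<Sum>k<n. w i k else 0) - w i j"
  using assms by (simp add: laplacian_def adjacency_mat_def mat_diag_def)

lemma laplacian_symmetric:
  assumes "weighted_graph n w"
  shows "transpose_mat (laplacian n w) = laplacian n w"
proof (rule eq_matI)
  fix i j assume "i < dim_row (laplacian n w)" "j < dim_col (laplacian n w)"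
  then have "i < n" "j < n" using laplacian_carrier[of n w] by auto
  then show "transpose_mat (laplacian n w) $$ (i, j) = laplacian n w $$ (i, j)"
    using laplacian_carrier[of n w] assms by (auto simp: laplacian_entry weighted_graph_def)
qed (use laplacian_carrier[of n w] in auto)

text \<open>The Dirichlet energy, which shows positive semidefiniteness. The factor 1/2 appears
  because each edge is counted in both orders.\<close>

lemma laplacian_quadratic_form:
  assumes w: "weighted_graph n w"
  shows "(\<Sum>i<n. \<Sum>j<n. x i * laplacian n w $$ (i, j) * x j)
    = (\<Sum>i<n. \<Sum>j<n. w i j * (x i - x j)\<^sup>2) / 2"
proof -
  let ?S = "\<Sum>i<n. \<Sum>j<n. w i j * (x i * x i)" and ?T = "\<Sum>i<n. \<Sum>j<n. w i j * (x i * x j)"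
  have "(\<Sum>j<n. x i * laplacian n w $$ (i, j) * x j)
      = (\<Sum>j<n. w i j * (x i * x i)) - (\<Sum>j<n. w i j * (x i * x j))" if "i < n" for i
  proof -
    have "(\<Sum>j<n. x i * laplacian n w $$ (i, j) * x j)
        = (\<Sum>j<n. (if i = j then (\<Sum>k<n. w i k) * (x i * x i) else 0) - w i j * (x i * x j))"
      using that by (intro sum.cong refl) (auto simp: laplacian_entry algebra_simps)
    also have "\<dots> = (\<Sum>j<n. w i j) * (x i * x i) - (\<Sum>j<n. w i j * (x i * x j))"
      unfolding sum_subtractf using that by simp
    finally show ?thesis by (simp add: sum_distrib_right)
  qed
  then have L: "(\<Sum>i<n. \<Sum>j<n. x i * laplacian n w $$ (i, j) * x j) = ?S - ?T"
    by (simp add: sum_subtractf)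
  \<comment> \<open>Symmetry of \<open>w\<close> lets the diagonal part be written with
    \<open>x j\<close> in place of \<open>x i\<close>; the two forms together complete the
    square.\<close>
  have "?S = (\<Sum>j<n. \<Sum>i<n. w i j * (x i * x i))" by (rule sum.swap)
  also have "\<dots> = (\<Sum>i<n. \<Sum>j<n. w i j * (x j * x j))"
    using w by (intro sum.cong refl) (auto simp: weighted_graph_def)
  finally have S: "?S = (\<Sum>i<n. \<Sum>j<n. w i j * (x j * x j))" .
  have "w i j * (x i - x j)\<^sup>2
      = w i j * (x i * x i) + w i j * (x j * x j) - 2 * (w i j * (x i * x j))" for i j
    by (simp add: power2_eq_square algebra_simps)
  then have "(\<Sum>i<n. \<Sum>j<n. w i j * (x i - x j)\<^sup>2)
      = ?S + (\<Sum>i<n. \<Sum>j<n. w i j * (x j * x j)) - 2 * ?T"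
    unfolding sum_distrib_left by (simp only: sum.distrib sum_subtractf)
  with L S show ?thesis by simp
qed

text \<open>The quadratic form at the unit eigenvector in column \<open>a\<close> of
  \<open>U\<close> equals \<open>d a\<close>.\<close>

lemma laplacian_eigenvalue_nonneg:
  assumes w: "weighted_graph n w" and sd: "spectral_decomposition (laplacian n w) U d" and a: "a < n"
  shows "0 \<le> d a"
proof -
  note c = laplacian_carrier[of n w]
  have "(\<Sum>i<n. \<Sum>j<n. U $$ (i, a) * laplacian n w $$ (i, j) * U $$ (j, a))
      = (\<Sum>i<n. U $$ (i, a) * (d a * U $$ (i, a)))"
    unfolding mult.assoc sum_distrib_left[symmetric]
    by (intro sum.cong refl) (simp add: eigen_equation[OF sd c] a)
  also have "\<dots> = d a * (\<Sum>i<n. U $$ (i, a) * U $$ (i, a))"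
    by (simp add: sum_distrib_left mult_ac)
  also have "\<dots> = d a" using orthogonal_cols[OF sd c a a] by simp
  finally have "d a = (\<Sum>i<n. \<Sum>j<n. w i j * (U $$ (i, a) - U $$ (j, a))\<^sup>2) / 2"
    using laplacian_quadratic_form[OF w, of "\<lambda>i. U $$ (i, a)"] by simp
  also have "0 \<le> \<dots>" using w by (auto simp: weighted_graph_def intro!: sum_nonneg divide_nonneg_pos)
  finally show ?thesis .
qed

text \<open>The sum is the \<open>(i, j)\<close> entry of \<open>(I - \<Delta> / r)\<^sup>k\<close>.\<close>

lemma walk_of_power_entry:
  assumes w: "weighted_graph n w" and sd: "spectral_decomposition (laplacian n w) U d"
    and "i < n" "j < n"
    and "(\<Sum>a<n. U $$ (i, a) * (1 - d a / r) ^ k * U $$ (j, a)) \<noteq> 0"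
  shows "\<exists>l\<le>k. (i, j) \<in> adj_rel n w ^^ l"
  using assms(3-)
proof (induction k arbitrary: i)
  case 0
  then show ?case
    using orthogonal_rows[OF sd laplacian_carrier, of i j] by (auto split: if_splits)
next
  case (Suc k)
  let ?L = "laplacian n w"
  let ?S = "\<lambda>i. \<Sum>a<n. U $$ (i, a) * (1 - d a / r) ^ k * U $$ (j, a)"
  \<comment> \<open>Splits one factor \<open>I - \<Delta> / r\<close> off on the left: the
    eigenvector equation turns \<open>d a * U $$ (i, a)\<close> into a sum over row \<open>i\<close>
    of the Laplacian.\<close>
  have "(\<Sum>a<n. U $$ (i, a) * (1 - d a / r) ^ Suc k * U $$ (j, a))
      = (\<Sum>a<n. U $$ (i, a) * (1 - d a / r) ^ k * U $$ (j, a)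
          - (d a * U $$ (i, a)) * ((1 - d a / r) ^ k * U $$ (j, a) / r))"
    by (intro sum.cong refl) (simp add: algebra_simps)
  also have "\<dots> = ?S i - (\<Sum>a<n. (\<Sum>l<n. ?L $$ (i, l) * U $$ (l, a)) * ((1 - d a / r) ^ k * U $$ (j, a) / r))"
    using Suc.prems by (simp add: sum_subtractf eigen_equation[OF sd laplacian_carrier])
  also have "(\<Sum>a<n. (\<Sum>l<n. ?L $$ (i, l) * U $$ (l, a)) * ((1 - d a / r) ^ k * U $$ (j, a) / r))
      = (\<Sum>a<n. \<Sum>l<n. ?L $$ (i, l) / r * (U $$ (l, a) * (1 - d a / r) ^ k * U $$ (j, a)))"
    unfolding sum_distrib_right by (intro sum.cong refl) (simp add: mult_ac)
  also have "\<dots> = (\<Sum>l<n. ?L $$ (i, l) / r * ?S l)"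
    unfolding sum_distrib_left by (rule sum.swap)
  finally have "?S i - (\<Sum>l<n. ?L $$ (i, l) / r * ?S l) \<noteq> 0" using Suc.prems by simp
  then have "?S i \<noteq> 0 \<or> (\<Sum>l<n. ?L $$ (i, l) / r * ?S l) \<noteq> 0" by linarith
  then have "\<exists>l<n. (l = i \<or> ?L $$ (i, l) \<noteq> 0) \<and> ?S l \<noteq> 0"
  proof
    assume "?S i \<noteq> 0"
    then show ?thesis using \<open>i < n\<close> by blast
  next
    assume "(\<Sum>l<n. ?L $$ (i, l) / r * ?S l) \<noteq> 0"
    then obtain l where l: "l \<in> {..<n}" and nz: "?L $$ (i, l) / r * ?S l \<noteq> 0"
      by (rule sum.not_neutral_contains_not_neutral)
    have "x \<noteq> 0 \<and> y \<noteq> 0" if "x / r * y \<noteq> 0" for x y :: real using that by auto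
    from this[OF nz] l show ?thesis by blast
  qed
  then obtain l where l: "l < n" "l = i \<or> ?L $$ (i, l) \<noteq> 0" "?S l \<noteq> 0"
    by blast
  obtain q where q: "q \<le> k" "(l, j) \<in> adj_rel n w ^^ q"
    using Suc.IH[OF l(1) \<open>j < n\<close> l(3)] by blast
  \<comment> \<open>Staying at \<open>i\<close> costs no edge, while moving to a neighbour prepends
    one. This is why the walk has at most, and not exactly, as many edges as the exponent.\<close>
  show ?case
  proof (cases "l = i")
    case True
    with q show ?thesis by (intro exI[of _ q]) simp
  next
    case False
    then have "w i l \<noteq> 0" using l(1,2) \<open>i < n\<close> by (simp add: laplacian_entry)
    then have "0 < w i l" using w l(1) \<open>i < n\<close> unfolding weighted_graph_def by (metis less_le)
    with l(1) \<open>i < n\<close> have "(i, l) \<in> adj_rel n w"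
      unfolding adj_rel_def edges_def by blast
    then have "(i, j) \<in> adj_rel n w ^^ Suc q" using q(2) by (rule relpow_Suc_I2)
    with q(1) show ?thesis by (intro exI[of _ "Suc q"]) simp
  qed
qed

section \<open>Decay of the weights between distant nodes\<close>

theorem proposition5p3:
  fixes \<alpha> :: real
  assumes "0 < \<alpha>" and "\<alpha> < 1"
  shows "\<exists>c::real. \<forall>(n::nat) (w :: nat \<Rightarrow> nat \<Rightarrow> real).
    weighted_graph n w \<and> connected_graph n w \<longrightarrow>
    (\<forall>i<n. \<forall>j<n. comb_dist n w i j \<ge> 2 \<longrightarrow>
      \<bar>rw n w \<alpha> i j\<bar>
        \<le> c * (spectral_radius_real (laplacian n w) / (2 * real (comb_dist n w i j) - 1)) powr \<alpha>)"
\<comment> \<open>The bound obtained has \<open>\<delta>\<close> as its denominator; the constant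
  pays for replacing \<open>\<delta>\<close> by \<open>(2 * \<delta> - 1) / 2\<close>.\<close>
proof (intro exI[of _ "2 powr \<alpha>"] allI impI)
  fix n w i j
  assume "weighted_graph n w \<and> connected_graph n w" and ij: "i < n" "j < n"
    and dist: "comb_dist n w i j \<ge> 2"
  then have w: "weighted_graph n w" by simp
  let ?L = "laplacian n w" and ?\<delta> = "comb_dist n w i j"
  define r where "r = spectral_radius_real ?L"
  obtain U d where sd: "spectral_decomposition ?L U d"
    using symmetric_spectral_decomposition[OF laplacian_carrier laplacian_symmetric[OF w]] by blast
  have d: "0 \<le> d a" "d a \<le> r" if "a < n" for a
    using laplacian_eigenvalue_nonneg[OF w sd that]
      abs_eigenvalue_le_spectral_radius[OF sd laplacian_carrier that] by (auto simp: r_def)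
  then have r: "0 \<le> r" using ij(1) by force
  have no_walk: "(i, j) \<notin> adj_rel n w ^^ l" if "l < ?\<delta>" for l
    using that not_less_Least unfolding comb_dist_def by blast
  \<comment> \<open>An edge would be a walk of length 1, below the distance. Hence \<open>rw\<close>
    takes its fractional Laplacian branch.\<close>
  then have "{i, j} \<notin> edges n w" using dist no_walk[of 1] by (auto simp: adj_rel_def)
  then have rw: "\<bar>rw n w \<alpha> i j\<bar> = \<bar>\<Sum>a<n. U $$ (i, a) * d a powr \<alpha> * U $$ (j, a)\<bar>"
    by (simp add: rw_def mat_powr_entry[OF sd laplacian_carrier ij])
  obtain m where m: "?\<delta> = Suc m" using dist by (cases ?\<delta>) auto
  \<comment> \<open>The values on the spectrum of the rescaled polynomial of degree at most
    \<open>m = \<delta> - 1\<close>. Expanding it in powers of \<open>1 - d a / r\<close> shows that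
    its matrix has zero \<open>(i, j)\<close> entry.\<close>
  let ?p = "\<lambda>a. r powr \<alpha> * powr_poly \<alpha> m (d a / r)"
  have "(\<Sum>a<n. U $$ (i, a) * (1 - d a / r) ^ k * U $$ (j, a)) = 0" if "k \<le> m" for k
    using walk_of_power_entry[OF w sd ij, of r k] no_walk m that by force
  then have "0 = (\<Sum>k\<le>m. r powr \<alpha> * binom_coeff \<alpha> k *
      (\<Sum>a<n. U $$ (i, a) * (1 - d a / r) ^ k * U $$ (j, a)))"
    by simp
  also have "\<dots> = (\<Sum>k\<le>m. \<Sum>a<n. r powr \<alpha> * binom_coeff \<alpha> k *
      (U $$ (i, a) * (1 - d a / r) ^ k * U $$ (j, a)))"
    by (simp add: sum_distrib_left)
  also have "\<dots> = (\<Sum>a<n. \<Sum>k\<le>m. r powr \<alpha> * binom_coeff \<alpha> k *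
      (U $$ (i, a) * (1 - d a / r) ^ k * U $$ (j, a)))"
    by (rule sum.swap)
  also have "\<dots> = (\<Sum>a<n. U $$ (i, a) * ?p a * U $$ (j, a))"
    unfolding powr_poly_def sum_distrib_left sum_distrib_right by (intro sum.cong refl) (simp add: mult_ac)
  finally have p0: "(\<Sum>a<n. U $$ (i, a) * ?p a * U $$ (j, a)) = 0" by simp
  have approx: "\<bar>d a powr \<alpha> - ?p a\<bar> \<le> r powr \<alpha> * real ?\<delta> powr - \<alpha>" if a: "a < n" for a
  \<comment> \<open>If \<open>r = 0\<close>, all eigenvalues vanish and both sides are 0, since
    \<open>0 powr \<alpha> = 0\<close>.\<close>
  proof (cases "r = 0")
    case True
    then show ?thesis using d[OF a] by simp
  next
    case False
    with r have r0: "0 < r" by simp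
    have x: "0 \<le> d a / r" "d a / r \<le> 1" using d[OF a] r0 by auto
    have "d a powr \<alpha> = r powr \<alpha> * (d a / r) powr \<alpha>"
      using r0 x by (simp flip: powr_mult)
    then have "\<bar>d a powr \<alpha> - ?p a\<bar> = r powr \<alpha> * \<bar>(d a / r) powr \<alpha> - powr_poly \<alpha> m (d a / r)\<bar>"
      by (simp add: abs_mult flip: right_diff_distrib)
    then show ?thesis
      using powr_poly_approx[OF assms x, of m] unfolding m by (simp add: mult_left_mono)
  qed
  \<comment> \<open>Subtracting the polynomial leaves the entry unchanged and makes every spectral
    coefficient small.\<close>
  have "\<bar>rw n w \<alpha> i j\<bar> = \<bar>\<Sum>a<n. U $$ (i, a) * (d a powr \<alpha> - ?p a) * U $$ (j, a)\<bar>"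
    unfolding rw using p0 by (simp add: algebra_simps sum_subtractf)
  also have "\<dots> \<le> r powr \<alpha> * real ?\<delta> powr - \<alpha>"
    using approx by (intro spectral_sum_le[OF sd laplacian_carrier ij])
  also have "\<dots> = (r / real ?\<delta>) powr \<alpha>"
    unfolding powr_minus_divide using r by (simp add: powr_divide)
  also have "\<dots> \<le> (2 * (r / (2 * real ?\<delta> - 1))) powr \<alpha>"
  proof (intro powr_mono2)
    show "r / real ?\<delta> \<le> 2 * (r / (2 * real ?\<delta> - 1))"
      using r dist by (simp add: divide_simps) (simp add: algebra_simps)
  qed (use r assms in auto)
  also have "\<dots> = 2 powr \<alpha> * (r / (2 * real ?\<delta> - 1)) powr \<alpha>"
    using r dist by (intro powr_mult)
  finally show "\<bar>rw n w \<alpha> i j\<bar> \<le> 2 powr \<alpha> * (spectral_radius_real ?L / (2 * real ?\<delta> - 1)) powr \<alpha>"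
    unfolding r_def .
qed

end
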